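(* Let $C=\mathfrak{c}(\mathbf{v}_1,\dots,\mathbf{v}_n)$ be the cone in $\mathbb{R}^n$ generated by linearly independent unit vectors $\mathbf{v}_1,\dots,\mathbf{v}_n$, and let $V$ be the $n\times n$ matrix whose column vectors are $\mathbf{v}_1,\dots,\mathbf{v}_n$. Suppose that $V^TV$ is tridiagonal, i.e. $\mathbf{v}_i\cdot\mathbf{v}_j=0$ whenever $|i-j|\ge2$, and write $\beta_i=\mathbf{v}_i\cdot\mathbf{v}_{i+1}$ for $1\le i\le n-1$. Then the associated matrix $M_n(C)$ has the same eigenvalues as $V^TV$. In particular, $M_n(C)$ is positive definite, and the power series $$T_{\boldsymbol\beta}=\frac{|\det V|}{(4\pi)^{n/2}}\sum_{\mathbf{b}\in\mathbb{N}^{n-1}}\left[\frac{(-2)^{\sum_{i=1}^{n-1}b_i}}{\prod_{i=1}^{n-1}b_i!}\,\Gamma\!\left(\tfrac{1+b_1}{2}\right)\Gamma\!\left(\tfrac{1+b_1+b_2}{2}\right)\cdots\Gamma\!\left(\tfrac{1+b_{n-2}+b_{n-1}}{2}\right)\Gamma\!\left(\tfrac{1+b_{n-1}}{2}\right)\right]\beta_1^{b_1}\cdots\beta_{n-1}^{b_{n-1}}$$ converges absolutely to the normalized solid angle measure $\tilde\Omega_n(C)$ of the cone $C$.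
   Context: $\mathfrak{c}(\mathbf{v}_1,\dots,\mathbf{v}_n)$ denotes the cone of all nonnegative linear combinations of $\mathbf{v}_1,\dots,\mathbf{v}_n$. The associated matrix $M_n(C)$ is the $n\times n$ matrix with $(i,j)$ entry $-|\mathbf{v}_i\cdot\mathbf{v}_j|$ for $i\ne j$ and diagonal entries $1$. The normalized solid angle measure is $\tilde\Omega_n(C)=\mathrm{vol}_{n-1}(C\cap S_{n-1})/\mathrm{vol}_{n-1}(S_{n-1})$, where $S_{n-1}$ is the unit sphere in $\mathbb{R}^n$ centered at the origin; equivalently $\tilde\Omega_n(C)=\pi^{-n/2}\int_C e^{-\|\mathbf{x}\|^2}d\mathbf{x}$. $\mathbb{N}$ includes $0$, $0^0=1$, and $\Gamma$ is Euler's Gamma function. Setting $b_0=b_n=0$, the product of Gamma factors in the series is $\prod_{i=1}^n\Gamma\left(\frac{1+b_{i-1}+b_i}{2}\right)$. *)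

theory Defs
  imports "HOL-Analysis.Analysis"
begin

definition gen_cone :: "('n::finite \<Rightarrow> 'a::real_vector) \<Rightarrow> 'a set" where
  "gen_cone v = {\<Sum>i\<in>UNIV. c i *\<^sub>R v i | c. \<forall>i. (0::real) \<le> c i}"

definition assoc_matrix :: "('n::finite \<Rightarrow> 'a::real_inner) \<Rightarrow> real ^ 'n ^ 'n" where
  "assoc_matrix v = (\<chi> i j. if i = j then 1 else - \<bar>v i \<bullet> v j\<bar>)"

definition eigenspace :: "real ^ 'n ^ 'n \<Rightarrow> real \<Rightarrow> (real ^ 'n) set" where
  "eigenspace A \<mu> = {x. A *v x = \<mu> *\<^sub>R x}"

definition eigenvalues :: "real ^ 'n ^ 'n \<Rightarrow> real set" where
  "eigenvalues A = {\<mu>. \<exists>x. x \<noteq> 0 \<and> x \<in> eigenspace A \<mu>}"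

definition positive_definite :: "real ^ 'n ^ 'n \<Rightarrow> bool" where
  "positive_definite A \<longleftrightarrow> transpose A = A \<and> (\<forall>x. x \<noteq> 0 \<longrightarrow> 0 < x \<bullet> (A *v x))"

text \<open>
  The surface measure \<open>vol\<^sub>n\<^sub>-\<^sub>1\<close> on the unit sphere of an \<open>n\<close>-dimensional Euclidean space, as it is
  defined through polar coordinates: the surface measure of \<open>A\<close> is \<open>n\<close> times the Lebesgue measure
  of the part of the unit ball lying over \<open>A\<close> (because the integral of \<open>r\<^sup>n\<^sup>-\<^sup>1\<close> over \<open>[0,1]\<close> is \<open>1/n\<close>).
  It is meaningful for subsets of the unit sphere only.  For \<open>n = 1\<close> it is the counting measure.
\<close>
definition sphere_vol :: "'a::euclidean_space set \<Rightarrow> real" where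
  "sphere_vol A =
     real DIM('a) * measure lebesgue {t *\<^sub>R x | t x. 0 \<le> t \<and> t \<le> 1 \<and> x \<in> A}"

definition solid_angle :: "'a::euclidean_space set \<Rightarrow> real" where
  "solid_angle C = sphere_vol (C \<inter> sphere 0 1) / sphere_vol (sphere (0::'a) 1)"

text \<open>
  \<open>\<nat>\<^sup>n\<^sup>-\<^sup>1\<close> as the set of sequences vanishing outside the positions \<open>1, \<dots>, n - 1\<close>; this makes the
  convention \<open>b\<^sub>0 = b\<^sub>n = 0\<close> automatic.
\<close>
definition multi_indices :: "nat \<Rightarrow> (nat \<Rightarrow> nat) set" where
  "multi_indices n = {b. \<forall>i. i \<notin> {1..<n} \<longrightarrow> b i = 0}"

definition angle_term :: "nat \<Rightarrow> (nat \<Rightarrow> real) \<Rightarrow> (nat \<Rightarrow> nat) \<Rightarrow> real" where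
  "angle_term n \<beta> b =
     ((-2) ^ (\<Sum>i\<in>{1..<n}. b i) / (\<Prod>i\<in>{1..<n}. fact (b i)) *
      (\<Prod>i\<in>{1..n}. Gamma ((1 + real (b (i - 1)) + real (b i)) / 2))) *
     (\<Prod>i\<in>{1..<n}. \<beta> i ^ b i)"

definition angle_series :: "real ^ 'n ^ 'n \<Rightarrow> (nat \<Rightarrow> real) \<Rightarrow> real" where
  "angle_series V \<beta> =
     \<bar>det V\<bar> / (4 * pi) powr (real CARD('n) / 2) *
     (\<Sum>\<^sub>\<infinity>b\<in>multi_indices CARD('n). angle_term CARD('n) \<beta> b)"

end

theory Submission
  imports Defs
begin

text \<open>
  Since the Gram matrix is tridiagonal, flipping the signs of suitable generators makes all
  its off-diagonal entries nonpositive; hence the associated matrix is conjugate to \<open>V\<^sup>TV\<close> by a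
  diagonal sign matrix.

  The solid angle is \<open>\<pi>\<^sup>-\<^sup>n\<^sup>/\<^sup>2\<close> times the integral of \<open>exp (-|x|\<^sup>2)\<close> over the cone, i.e. \<open>|det V| \<pi>\<^sup>-\<^sup>n\<^sup>/\<^sup>2\<close> times
  the integral of \<open>exp (-|Vc|\<^sup>2) = exp (-|c|\<^sup>2) \<Prod>\<^sub>k exp (-2 \<beta>\<^sub>k c\<^sub>k c\<^sub>k\<^sub>+\<^sub>1)\<close> over the orthant. Expanding the
  exponentials and integrating termwise yields the series. By Fubini this is legitimate because
  the sum of the absolute values of the terms is \<open>exp (-c\<^sup>TMc)\<close> for the associated matrix \<open>M\<close>,
  which is integrable as \<open>M\<close> is positive definite.
\<close>

section \<open>Linear images of compact sets\<close>

text \<open>A well-ordered copy of a finite index type: \<open>measure_linear_image\<close> needs a well-order.\<close>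

typedef (overloaded) ('n::finite) fin_index = "{..<CARD('n)}"
  by (auto intro: exI[of _ 0])

setup_lifting type_definition_fin_index

instantiation fin_index :: (finite) linorder
begin

lift_definition less_eq_fin_index :: "'a fin_index \<Rightarrow> 'a fin_index \<Rightarrow> bool" is "(\<le>)" .
lift_definition less_fin_index :: "'a fin_index \<Rightarrow> 'a fin_index \<Rightarrow> bool" is "(<)" .

instance
  by standard (transfer; force)+

end

instance fin_index :: (finite) wellorder
proof
  fix P :: "'a fin_index \<Rightarrow> bool" and a
  assume step: "\<And>x. (\<And>y. y < x \<Longrightarrow> P y) \<Longrightarrow> P x"
  show "P a"
  proof (induction "Rep_fin_index a" arbitrary: a rule: less_induct)
    case less
    show ?case
      by (rule step, rule less) (simp add: less_fin_index.rep_eq)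
  qed
qed

instance fin_index :: (finite) finite
proof
  show "finite (UNIV :: 'a fin_index set)"
    by (simp add: type_definition.univ[OF type_definition_fin_index])
qed

lemma card_fin_index: "CARD('n::finite fin_index) = CARD('n)"
  by (simp add: type_definition.card[OF type_definition_fin_index])

text \<open>Conjugation by \<open>f\<close> is a sign-preserving bijection between the permutations
  of the two index types, so it matches the terms of the two Leibniz sums.\<close>

lemma det_reindex:
  fixes A :: "'a::comm_ring_1 ^ 'n ^ 'n" and f :: "'m::finite \<Rightarrow> 'n::finite"
  assumes "bij f"
  shows "det (\<chi> i j. A $ f i $ f j) = det A"
proof -
  have inj: "inj f" and surj: "surj f"
    using assms by (auto simp: bij_def)
  have bij: "bij_betw (map_permutation UNIV f) {p. p permutes UNIV} {p. p permutes UNIV}"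
  proof (rule bij_betwI[where g = "map_permutation UNIV (inv f)"])
    have "bij (inv f)" using assms by (rule bij_imp_bij_inv)
    then show "map_permutation UNIV f \<in> {p. p permutes UNIV} \<rightarrow> {p. p permutes UNIV}"
      "map_permutation UNIV (inv f) \<in> {p. p permutes UNIV} \<rightarrow> {p. p permutes UNIV}"
      using assms by (auto intro: map_permutation_permutes)
    show "map_permutation UNIV (inv f) (map_permutation UNIV f p) = p"
      if "p \<in> {p. p permutes UNIV}" for p
      using assms that inj by (intro map_permutation_compose_inv) auto
    show "map_permutation UNIV f (map_permutation UNIV (inv f) p) = p"
      if "p \<in> {p. p permutes UNIV}" for p
      using \<open>bij (inv f)\<close> that surj by (intro map_permutation_compose_inv) (auto simp: surj_f_inv_f)
  qed
  have "of_int (sign (map_permutation UNIV f p)) * (\<Prod>i\<in>UNIV. A $ i $ map_permutation UNIV f p i)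
      = of_int (sign p) * (\<Prod>i\<in>UNIV. A $ f i $ f (p i))" if "p permutes UNIV" for p
  proof -
    have "(\<Prod>i\<in>UNIV. A $ i $ map_permutation UNIV f p i)
        = (\<Prod>i\<in>UNIV. A $ f i $ map_permutation UNIV f p (f i))"
      using prod.reindex_bij_betw[OF assms, of "\<lambda>i. A $ i $ map_permutation UNIV f p i"] by simp
    then show ?thesis
      using inj that by (simp add: map_permutation_apply sign_map_permutation)
  qed
  then show ?thesis
    unfolding det_def by (subst sum.reindex_bij_betw[OF bij, symmetric]) (auto intro!: sum.cong)
qed

lemma borel_measurable_reindex:
  "(\<lambda>x::real^'n. \<chi> i. x $ f i) \<in> borel_measurable (borel :: (real^'n) measure)"
  by (intro borel_measurable_continuous_onI continuous_intros)

text \<open>Lebesgue measure is determined by its values on boxes, and renaming coordinates turns a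
  box into one with the same side lengths in another order.\<close>

lemma distr_lborel_reindex:
  fixes f :: "'m::finite \<Rightarrow> 'n::finite"
  assumes "bij f"
  shows "distr lborel borel (\<lambda>x::real^'n. \<chi> i. x $ f i) = lborel"
proof (rule lborel_eqI[symmetric])
  fix l u :: "real^'m"
  assume le: "\<And>b. b \<in> Basis \<Longrightarrow> l \<bullet> b \<le> u \<bullet> b"
  have le': "l $ i \<le> u $ i" for i
    using le[of "axis i 1"] by (simp add: inner_axis)
  define l' u' where "l' = (\<chi> j. l $ inv f j)" and "u' = (\<chi> j. u $ inv f j)"
  have prod_basis: "(\<Prod>b\<in>Basis. (y - x) \<bullet> b) = (\<Prod>i\<in>UNIV. y $ i - x $ i)" for x y :: "real^'k::finite"
  proof -
    have Basis: "(Basis :: (real^'k) set) = (\<lambda>i. axis i 1) ` UNIV"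
      by (auto simp: Basis_vec_def)
    show ?thesis
      unfolding Basis by (subst prod.reindex) (auto simp: inj_on_def axis_eq_axis inner_axis)
  qed
  have "(\<lambda>x. \<chi> i. x $ f i) -` box l u = box l' u'"
  proof -
    have "(\<forall>i. l $ i < x $ f i \<and> x $ f i < u $ i)
        \<longleftrightarrow> (\<forall>j. l $ inv f j < x $ j \<and> x $ j < u $ inv f j)" for x :: "real^'n"
      using assms by (metis bij_inv_eq_iff)
    then show ?thesis
      by (auto simp: mem_box_cart l'_def u'_def)
  qed
  moreover have "l' \<bullet> b \<le> u' \<bullet> b" if "b \<in> Basis" for b
    using that le' by (auto simp: Basis_vec_def inner_axis l'_def u'_def)
  ultimately have "emeasure (distr lborel borel (\<lambda>x. \<chi> i. x $ f i)) (box l u)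
      = (\<Prod>j\<in>UNIV. u' $ j - l' $ j)"
    by (simp add: emeasure_distr borel_measurable_reindex emeasure_lborel_box prod_basis)
  also have "(\<Prod>j\<in>UNIV. u' $ j - l' $ j) = (\<Prod>i\<in>UNIV. u' $ f i - l' $ f i)"
    using prod.reindex_bij_betw[OF assms, of "\<lambda>j. u' $ j - l' $ j"] by simp
  also have "\<dots> = (\<Prod>b\<in>Basis. (u - l) \<bullet> b)"
    using assms by (simp add: prod_basis l'_def u'_def bij_is_inj)
  finally show "emeasure (distr lborel borel (\<lambda>x. \<chi> i. x $ f i)) (box l u)
      = (\<Prod>b\<in>Basis. (u - l) \<bullet> b)" .
qed simp

lemma compact_matrix_image:
  fixes V :: "real ^ 'n ^ 'm"
  assumes "compact S"
  shows "compact ((*v) V ` S)"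
  using assms by (intro compact_continuous_image continuous_intros)

text \<open>The renaming of coordinates \<open>R\<close> preserves volume and carries
  \<open>V\<close> to \<open>W\<close>, which has the same determinant, so
  \<open>measure_linear_image\<close> can be applied to \<open>W\<close>. Compactness keeps all
  images Borel, where \<open>lebesgue\<close> and \<open>lborel\<close> agree.\<close>

lemma measure_matrix_image:
  fixes V :: "real ^ 'n::finite ^ 'n"
  assumes S: "compact S"
  shows "measure lborel ((*v) V ` S) = \<bar>det V\<bar> * measure lborel S"
proof -
  have "CARD('n fin_index) = CARD('n)"
    by (rule card_fin_index)
  then obtain f :: "'n fin_index \<Rightarrow> 'n" where f: "bij f"
    using finite_same_card_bij[of "UNIV :: 'n fin_index set" "UNIV :: 'n set"] by auto
  define R :: "real^'n \<Rightarrow> real^'n fin_index" where "R = (\<lambda>x. \<chi> i. x $ f i)"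
  define W :: "real ^ 'n fin_index ^ 'n fin_index" where "W = (\<chi> i j. V $ f i $ f j)"
  have inj: "inj R"
  proof (rule injI)
    fix x y :: "real^'n" assume "R x = R y"
    then have "x $ f i = y $ f i" for i
      by (simp add: R_def vec_eq_iff)
    then show "x = y"
      using bij_is_surj[OF f] by (metis vec_eq_iff surj_def)
  qed
  have compact_R: "compact (R ` T)" if "compact T" for T
    using that unfolding R_def by (intro compact_continuous_image continuous_intros)
  have R: "measure lborel (R ` T) = measure lborel T" if "compact T" for T
  proof -
    have "measure lborel (R ` T) = measure (distr lborel borel R) (R ` T)"
      using distr_lborel_reindex[OF f] by (simp add: R_def)
    also have "\<dots> = measure lborel (R -` R ` T)"
      using compact_R[OF that]
      by (subst measure_distr) (auto simp: R_def borel_measurable_reindex compact_imp_closed borel_closed)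
    finally show ?thesis
      using inj by (simp add: inj_vimage_image_eq)
  qed
  have "R (V *v x) = W *v R x" for x
  proof -
    have "(\<Sum>j\<in>UNIV. V $ i $ j * x $ j) = (\<Sum>k\<in>UNIV. V $ i $ f k * x $ f k)" for i
      using sum.reindex_bij_betw[OF f, of "\<lambda>j. V $ i $ j * x $ j"] by simp
    then show ?thesis
      by (simp add: R_def W_def matrix_vector_mult_def vec_eq_iff)
  qed
  then have img: "R ` (*v) V ` S = (*v) W ` R ` S"
    by (auto simp: image_image)
  have "measure lborel ((*v) V ` S) = measure lborel ((*v) W ` R ` S)"
    using R[OF compact_matrix_image[OF S, of V]] by (simp add: img)
  also have "\<dots> = measure lebesgue ((*v) W ` R ` S)"
    by (simp add: S compact_R compact_matrix_image compact_imp_closed borel_closed)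
  also have "\<dots> = \<bar>det (matrix ((*v) W))\<bar> * measure lebesgue (R ` S)"
    by (intro measure_linear_image lmeasurable_compact compact_R S) auto
  also have "\<dots> = \<bar>det V\<bar> * measure lborel S"
    using R[OF S] S f by (simp add: W_def det_reindex compact_R compact_imp_closed borel_closed)
  finally show ?thesis .
qed

section \<open>Gaussian integrals by the layer-cake formula\<close>

text \<open>Since \<open>exp (- q x)\<close> is the integral of \<open>exp (- s)\<close> over
  \<open>s \<ge> q x\<close>, exchanging the two integrals reduces the problem to the sublevel sets
  of \<open>q\<close>. The weight \<open>w\<close> will be a power on the half-line or the indicator
  of a cone.\<close>

lemma nn_integral_exp_layer_cake:
  assumes "sigma_finite_measure M"
    and [measurable]: "w \<in> borel_measurable M" "q \<in> borel_measurable M"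
    and nonneg: "\<And>x. 0 \<le> q x"
  shows "(\<integral>\<^sup>+x. w x * ennreal (exp (- q x)) \<partial>M)
    = (\<integral>\<^sup>+s. (\<integral>\<^sup>+x. w x * indicator {x. q x \<le> s} x \<partial>M)
        * ennreal (indicator {0..} s * exp (- s)) \<partial>lborel)"
proof -
  interpret M: sigma_finite_measure M by fact
  interpret pair_sigma_finite M "lborel :: real measure" ..
  have tail: "(\<integral>\<^sup>+s. ennreal (exp (- s)) * indicator {a..} s \<partial>lborel) = ennreal (exp (- a))" for a :: real
  proof -
    have "((\<lambda>x::real. - exp (- x)) \<longlongrightarrow> - 0) at_top"
      by (intro tendsto_minus filterlim_compose[OF exp_at_bot filterlim_uminus_at_bot_at_top])
    then show ?thesis
      by (subst nn_integral_FTC_atLeast[where F = "\<lambda>x. - exp (- x)" and T = 0])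
        (auto intro!: derivative_eq_intros)
  qed
  have "(\<integral>\<^sup>+x. w x * ennreal (exp (- q x)) \<partial>M)
      = (\<integral>\<^sup>+x. \<integral>\<^sup>+s. w x * indicator {x. q x \<le> s} x * ennreal (indicator {0..} s * exp (- s)) \<partial>lborel \<partial>M)"
  proof (rule nn_integral_cong)
    fix x
    have "(\<integral>\<^sup>+s. w x * indicator {x. q x \<le> s} x * ennreal (indicator {0..} s * exp (- s)) \<partial>lborel)
        = (\<integral>\<^sup>+s. w x * (ennreal (exp (- s)) * indicator {q x..} s) \<partial>lborel)"
      using nonneg[of x] by (intro nn_integral_cong) (auto split: split_indicator)
    also have "\<dots> = w x * ennreal (exp (- q x))"
      by (subst nn_integral_cmult) (auto simp: tail)
    finally show "w x * ennreal (exp (- q x))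
      = (\<integral>\<^sup>+s. w x * indicator {x. q x \<le> s} x * ennreal (indicator {0..} s * exp (- s)) \<partial>lborel)" ..
  qed
  also have "\<dots> = (\<integral>\<^sup>+s. \<integral>\<^sup>+x. w x * indicator {x. q x \<le> s} x * ennreal (indicator {0..} s * exp (- s)) \<partial>M \<partial>lborel)"
    by (rule Fubini'[symmetric]) (simp add: indicator_def, measurable)
  also have "\<dots> = (\<integral>\<^sup>+s. (\<integral>\<^sup>+x. w x * indicator {x. q x \<le> s} x \<partial>M)
        * ennreal (indicator {0..} s * exp (- s)) \<partial>lborel)"
    by (intro nn_integral_cong nn_integral_multc) (simp add: indicator_def)
  finally show ?thesis .
qed

text \<open>Euler's integral, with the density in the form that the layer-cake formula
  produces.\<close>

lemma nn_integral_powr_exp: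
  assumes "0 < a"
  shows "(\<integral>\<^sup>+s. ennreal (s powr (a - 1)) * ennreal (indicator {0..} s * exp (- s)) \<partial>lborel) = ennreal (Gamma a)"
  unfolding Gamma_conv_nn_integral_real[OF assms]
  by (intro nn_integral_cong)
    (auto simp: ennreal_mult'[symmetric] exp_minus field_simps split: split_indicator)

text \<open>Layer cake with \<open>q t = t\<^sup>2\<close>: the inner integral of
  \<open>t ^ k\<close> runs over \<open>{0..sqrt s}\<close> and is elementary, and the outer one is
  Euler's integral.\<close>

lemma nn_integral_half_gaussian_moment:
  "(\<integral>\<^sup>+t. ennreal (indicator {0..} t * t ^ k * exp (- t\<^sup>2)) \<partial>lborel)
    = ennreal (Gamma ((1 + real k) / 2) / 2)"
proof -
  have "(\<integral>\<^sup>+t. ennreal (indicator {0..} t * t ^ k * exp (- t\<^sup>2)) \<partial>lborel)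
      = (\<integral>\<^sup>+t. ennreal (indicator {0..} t * t ^ k) * ennreal (exp (- t\<^sup>2)) \<partial>lborel)"
    by (intro nn_integral_cong) (auto simp: ennreal_mult' split: split_indicator)
  also have "\<dots> = (\<integral>\<^sup>+s. (\<integral>\<^sup>+t. ennreal (indicator {0..} t * t ^ k) * indicator {t. t\<^sup>2 \<le> s} t \<partial>lborel)
      * ennreal (indicator {0..} s * exp (- s)) \<partial>lborel)"
    by (rule nn_integral_exp_layer_cake) (auto intro: sigma_finite_lborel)
  \<comment> \<open>The exponent \<open>(k + 1) / 2\<close> is written as \<open>a - 1\<close> with
    \<open>a = (3 + k) / 2\<close> to fit Euler's integral.\<close>
  also have "\<dots> = (\<integral>\<^sup>+s. ennreal (1 / (1 + real k)) *
      (ennreal (s powr ((3 + real k) / 2 - 1)) * ennreal (indicator {0..} s * exp (- s))) \<partial>lborel)"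
  proof (rule nn_integral_cong)
    fix s :: real
    show "(\<integral>\<^sup>+t. ennreal (indicator {0..} t * t ^ k) * indicator {t. t\<^sup>2 \<le> s} t \<partial>lborel)
        * ennreal (indicator {0..} s * exp (- s))
      = ennreal (1 / (1 + real k)) *
      (ennreal (s powr ((3 + real k) / 2 - 1)) * ennreal (indicator {0..} s * exp (- s)))"
    proof (cases "0 \<le> s")
      case True
      have "(\<integral>\<^sup>+t. ennreal (indicator {0..} t * t ^ k) * indicator {t. t\<^sup>2 \<le> s} t \<partial>lborel)
          = (\<integral>\<^sup>+t. ennreal (t ^ k) * indicator {0..sqrt s} t \<partial>lborel)"
        using True by (intro nn_integral_cong)
          (auto split: split_indicator intro: real_le_rsqrt dest: real_sqrt_le_mono
            simp: real_sqrt_ge_abs1 sqrt_ge_absD)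
      also have "\<dots> = ennreal (sqrt s ^ (k + 1) / (1 + real k) - 0 ^ (k + 1) / (1 + real k))"
      proof (intro nn_integral_FTC_Icc)
        show "((\<lambda>t. t ^ (k + 1) / (1 + real k)) has_real_derivative t ^ k) (at t)" for t
          using DERIV_cdivide[OF DERIV_pow[of "k + 1" t], where c = "1 + real k"]
          by (simp add: add_eq_0_iff)
      qed (use True in auto)
      also have "sqrt s ^ (k + 1) / (1 + real k) - 0 ^ (k + 1) / (1 + real k)
          = (1 / (1 + real k)) * s powr ((3 + real k) / 2 - 1)"
      proof -
        have "sqrt s ^ (k + 1) = s powr ((3 + real k) / 2 - 1)"
        \<comment> \<open>\<open>powr_realpow\<close> asks for a positive base; at
          \<open>s = 0\<close> both sides are \<open>0\<close>, because
          \<open>0 powr a = 0\<close>.\<close>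
        proof (cases "s = 0")
          case False
          with True have "0 < sqrt s"
            by simp
          then have "sqrt s ^ (k + 1) = sqrt s powr real (k + 1)"
            by (rule powr_realpow[symmetric])
          also have "\<dots> = (s powr (1/2)) powr real (k + 1)"
            using True by (simp only: powr_half_sqrt)
          also have "\<dots> = s powr ((3 + real k) / 2 - 1)"
            unfolding powr_powr by (simp add: field_simps)
          finally show ?thesis .
        qed simp
        then show ?thesis by simp
      qed
      finally show ?thesis
        by (subst (asm) ennreal_mult') (simp_all only: mult.assoc, simp)
    qed simp
  qed
  also have "\<dots> = ennreal (1 / (1 + real k)) * ennreal (Gamma ((3 + real k) / 2))"
    by (subst nn_integral_cmult) (simp_all add: nn_integral_powr_exp)
  also have "\<dots> = ennreal (1 / (1 + real k) * Gamma ((3 + real k) / 2))"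
    by (subst ennreal_mult') simp_all
  \<comment> \<open>The functional equation of Gamma cancels \<open>1 + k\<close> and leaves the
    factor \<open>1 / 2\<close>.\<close>
  also have "1 / (1 + real k) * Gamma ((3 + real k) / 2) = Gamma ((1 + real k) / 2) / 2"
  proof -
    have "(1 + real k) / 2 \<notin> \<int>\<^sub>\<le>\<^sub>0"
      by (auto elim!: nonpos_Ints_cases simp: field_simps)
    then have "Gamma ((1 + real k) / 2 + 1) = (1 + real k) / 2 * Gamma ((1 + real k) / 2)"
      by (rule Gamma_plus1)
    moreover have "(1 + real k) / 2 + 1 = (3 + real k) / 2"
      by simp
    ultimately have "Gamma ((3 + real k) / 2) = (1 + real k) / 2 * Gamma ((1 + real k) / 2)"
      by simp
    then show ?thesis
      by simp
  qed
  finally show ?thesis .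
qed

text \<open>By homogeneity the part of \<open>K\<close> where \<open>q \<le> s\<close> is the part
  where \<open>q \<le> 1\<close>, scaled by \<open>sqrt s\<close>. Its volume therefore grows like
  \<open>s powr (DIM('a) / 2)\<close>, and the layer-cake integral over \<open>s\<close> becomes a
  Gamma value.\<close>

lemma nn_integral_exp_quadratic_cone:
  fixes q :: "'a::euclidean_space \<Rightarrow> real"
  assumes [measurable]: "q \<in> borel_measurable borel" "K \<in> sets borel"
    and nonneg: "\<And>x. 0 \<le> q x"
    and hom: "\<And>t x. q (t *\<^sub>R x) = t\<^sup>2 * q x"
    and cone: "\<And>t x. 0 < t \<Longrightarrow> x \<in> K \<Longrightarrow> t *\<^sub>R x \<in> K"
  shows "(\<integral>\<^sup>+x. ennreal (indicator K x * exp (- q x)) \<partial>lborel)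
    = ennreal (Gamma (real DIM('a) / 2 + 1)) * emeasure lborel {x \<in> K. q x \<le> 1}"
proof -
  define S where "S s = {x \<in> K. q x \<le> s}" for s
  have [measurable]: "S s \<in> sets borel" for s
    unfolding S_def by simp
  have scale: "emeasure lborel (S s) = emeasure lborel (S 1) * ennreal (s powr (real DIM('a) / 2 + 1 - 1))"
    if "0 < s" for s
  proof -
    have "S s = (*\<^sub>R) (sqrt s) ` S 1"
    proof (intro set_eqI iffI)
      fix x assume "x \<in> S s"
      with that have "x = sqrt s *\<^sub>R (1 / sqrt s) *\<^sub>R x" "(1 / sqrt s) *\<^sub>R x \<in> S 1"
        by (auto simp: S_def hom cone power_divide)
      then show "x \<in> (*\<^sub>R) (sqrt s) ` S 1" by blast
    qed (use that in \<open>auto simp: S_def hom cone\<close>)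
    then have "emeasure lebesgue (S s) = ennreal (\<bar>sqrt s\<bar> ^ DIM('a)) * emeasure lebesgue (S 1)"
      using emeasure_lebesgue_affine[of "sqrt s" 0 "S 1"] by (simp add: ennreal_power)
    moreover have "\<bar>sqrt s\<bar> ^ DIM('a) = s powr (real DIM('a) / 2)"
    proof -
      have "\<bar>sqrt s\<bar> ^ DIM('a) = (s powr (1/2)) powr real DIM('a)"
        using that by (simp add: powr_half_sqrt powr_realpow)
      then show ?thesis
        unfolding powr_powr by simp
    qed
    ultimately show ?thesis
      by (simp add: mult.commute)
  qed
  have "(\<integral>\<^sup>+x. ennreal (indicator K x * exp (- q x)) \<partial>lborel)
      = (\<integral>\<^sup>+x. indicator K x * ennreal (exp (- q x)) \<partial>lborel)"
    by (intro nn_integral_cong) (auto split: split_indicator)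
  also have "\<dots> = (\<integral>\<^sup>+s. (\<integral>\<^sup>+x. indicator K x * indicator {x. q x \<le> s} x \<partial>lborel)
      * ennreal (indicator {0..} s * exp (- s)) \<partial>lborel)"
    by (rule nn_integral_exp_layer_cake) (auto intro: sigma_finite_lborel nonneg)
  also have "\<dots> = (\<integral>\<^sup>+s. emeasure lborel (S 1) * (ennreal (s powr (real DIM('a) / 2 + 1 - 1))
      * ennreal (indicator {0..} s * exp (- s))) \<partial>lborel)"
  \<comment> \<open>The scaling covers \<open>s > 0\<close>; for \<open>s < 0\<close> both sides
    vanish through the indicator, and the single point \<open>s = 0\<close> is null.\<close>
  proof (rule nn_integral_cong_AE, use AE_lborel_singleton[of 0] in eventually_elim)
    fix s :: real assume "s \<noteq> 0"
    have "(\<integral>\<^sup>+x. indicator K x * indicator {x. q x \<le> s} x \<partial>lborel)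
        = (\<integral>\<^sup>+x. indicator (S s) x \<partial>lborel)"
      by (intro nn_integral_cong) (auto simp: S_def split: split_indicator)
    then have "(\<integral>\<^sup>+x. indicator K x * indicator {x. q x \<le> s} x \<partial>lborel) = emeasure lborel (S s)"
      by simp
    with \<open>s \<noteq> 0\<close> show "(\<integral>\<^sup>+x. indicator K x * indicator {x. q x \<le> s} x \<partial>lborel)
        * ennreal (indicator {0..} s * exp (- s))
      = emeasure lborel (S 1) * (ennreal (s powr (real DIM('a) / 2 + 1 - 1))
        * ennreal (indicator {0..} s * exp (- s)))"
      by (cases "0 < s") (simp_all only: scale[of s] mult.assoc, simp)
  qed
  also have "\<dots> = emeasure lborel (S 1) * ennreal (Gamma (real DIM('a) / 2 + 1))"
    by (subst nn_integral_cmult) (measurable, subst nn_integral_powr_exp, auto)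
  finally show ?thesis
    by (simp add: S_def mult.commute)
qed

section \<open>The solid angle as an orthant integral\<close>

abbreviation orthant :: "(real ^ 'n) set" where
  "orthant \<equiv> {c. \<forall>i. 0 \<le> c $ i}"

lemma closed_orthant: "closed (orthant :: (real ^ 'n::finite) set)"
proof -
  have "(orthant :: (real ^ 'n) set) = (\<Inter>i. {c. 0 \<le> c $ i})"
    by auto
  also have "closed \<dots>"
    by (intro closed_INT ballI closed_Collect_le continuous_intros)
  finally show ?thesis .
qed

lemma gen_cone_eq_image:
  fixes V :: "real ^ 'n::finite ^ 'm::finite"
  assumes "\<And>j. column j V = v j"
  shows "gen_cone v = (*v) V ` orthant"
proof -
  have *: "V *v c = (\<Sum>i\<in>UNIV. c $ i *\<^sub>R v i)" for c
    by (simp add: matrix_mult_sum scalar_mult_eq_scaleR assms)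
  show ?thesis
  proof (intro set_eqI iffI)
    fix x assume "x \<in> gen_cone v"
    then obtain c where c: "\<forall>i. 0 \<le> c i" "x = (\<Sum>i\<in>UNIV. c i *\<^sub>R v i)"
      unfolding gen_cone_def by blast
    then have "x = V *v (\<chi> i. c i)" "(\<chi> i. c i) \<in> orthant"
      by (simp_all add: *)
    then show "x \<in> (*v) V ` orthant" by blast
  next
    fix x assume "x \<in> (*v) V ` orthant"
    then obtain c where "\<forall>i. 0 \<le> c $ i" "x = (\<Sum>i\<in>UNIV. c $ i *\<^sub>R v i)"
      by (auto simp: *)
    then show "x \<in> gen_cone v"
      unfolding gen_cone_def by blast
  qed
qed

text \<open>A nonzero point of the cone is its norm times its direction, and the direction lies in
  the cone and on the sphere. The segments from the origin to these directions thus fill the part of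
  the cone in the unit ball.\<close>

lemma sphere_vol_cone:
  fixes C :: "'a::euclidean_space set"
  assumes cone: "\<And>t x. 0 \<le> t \<Longrightarrow> x \<in> C \<Longrightarrow> t *\<^sub>R x \<in> C"
    and "w \<in> C" "w \<noteq> 0"
  shows "sphere_vol (C \<inter> sphere 0 1) = real DIM('a) * measure lebesgue (C \<inter> cball 0 1)"
proof -
  have "{t *\<^sub>R x | t x. 0 \<le> t \<and> t \<le> 1 \<and> x \<in> C \<inter> sphere 0 1} = C \<inter> cball 0 1"
  proof (intro set_eqI iffI)
    fix y assume y: "y \<in> C \<inter> cball 0 1"
    \<comment> \<open>The origin has no direction of its own and borrows that of
      \<open>w\<close>.\<close>
    define u where "u = (if y = 0 then w else y)"
    have u: "u \<in> C" "u \<noteq> 0"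
      using y assms by (auto simp: u_def)
    then have "y = norm y *\<^sub>R (1 / norm u) *\<^sub>R u" "(1 / norm u) *\<^sub>R u \<in> C \<inter> sphere 0 1"
      using cone[of "1 / norm u" u] by (auto simp: u_def)
    then show "y \<in> {t *\<^sub>R x | t x. 0 \<le> t \<and> t \<le> 1 \<and> x \<in> C \<inter> sphere 0 1}"
      using y by (intro CollectI exI[of _ "norm y"] exI[of _ "(1 / norm u) *\<^sub>R u"]) simp
  qed (auto simp: cone)
  then show ?thesis
    by (simp add: sphere_vol_def)
qed

text \<open>An injective linear map satisfies \<open>B * norm x \<le> norm (V *v x)\<close> for some
  \<open>B > 0\<close>, which bounds the set; continuity makes it closed.\<close>

lemma compact_orthant_unit:
  fixes V :: "real ^ 'n::finite ^ 'm::finite"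
  assumes "inj ((*v) V)"
  shows "compact {c \<in> orthant. (norm (V *v c))\<^sup>2 \<le> 1}"
proof -
  obtain B where B: "B > 0" "\<And>x. B * norm x \<le> norm (V *v x)"
    using linear_inj_bounded_below_pos[of "(*v) V"] assms by auto
  have "{c. (norm (V *v c))\<^sup>2 \<le> 1} \<subseteq> cball 0 (1 / B)"
  proof
    fix c assume "c \<in> {c. (norm (V *v c))\<^sup>2 \<le> 1}"
    then have "norm (V *v c) \<le> 1"
      by (simp add: power_le_one_iff abs_square_le_1)
    with B(2)[of c] have "B * norm c \<le> 1"
      by linarith
    with B(1) show "c \<in> cball 0 (1 / B)"
      by (simp add: field_simps)
  qed
  moreover have "closed {c. (norm (V *v c))\<^sup>2 \<le> 1}"
    by (intro closed_Collect_le continuous_intros)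
  ultimately have "compact {c. (norm (V *v c))\<^sup>2 \<le> 1}"
    using bounded_cball bounded_subset compact_eq_bounded_closed by blast
  then have "compact (orthant \<inter> {c. (norm (V *v c))\<^sup>2 \<le> 1})"
    by (rule closed_Int_compact[OF closed_orthant])
  moreover have "{c \<in> orthant. (norm (V *v c))\<^sup>2 \<le> 1} = orthant \<inter> {c. (norm (V *v c))\<^sup>2 \<le> 1}"
    by auto
  ultimately show ?thesis
    by simp
qed

text \<open>Compactness makes the volume in the cone formula finite. The lemma serves twice: it
  evaluates the integral for the matrix of generators, and it gives integrability after a change of
  signs.\<close>

lemma has_bochner_integral_orthant_gaussian:
  fixes V :: "real ^ 'n::finite ^ 'm::finite"
  assumes "inj ((*v) V)"
  shows "has_bochner_integral lborel (\<lambda>c. indicator orthant c * exp (- (norm (V *v c))\<^sup>2))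
    (Gamma (real CARD('n) / 2 + 1) * measure lborel {c \<in> orthant. (norm (V *v c))\<^sup>2 \<le> 1})"
proof (rule has_bochner_integral_nn_integral)
  have [measurable]: "(orthant :: (real^'n) set) \<in> sets borel"
    using closed_orthant by (rule borel_closed)
  have [measurable]: "(\<lambda>c. norm (V *v c)) \<in> borel_measurable borel"
    by (intro borel_measurable_continuous_onI continuous_intros)
  show "(\<lambda>c. indicator orthant c * exp (- (norm (V *v c))\<^sup>2)) \<in> borel_measurable lborel"
    by measurable
  have "emeasure lborel {c \<in> orthant. (norm (V *v c))\<^sup>2 \<le> 1} < \<infinity>"
    using compact_orthant_unit[OF assms] by (intro emeasure_bounded_finite compact_imp_bounded)
  then have "emeasure lborel {c \<in> orthant. (norm (V *v c))\<^sup>2 \<le> 1}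
      = ennreal (measure lborel {c \<in> orthant. (norm (V *v c))\<^sup>2 \<le> 1})"
    by (intro emeasure_eq_ennreal_measure) auto
  then show "(\<integral>\<^sup>+c. ennreal (indicator orthant c * exp (- (norm (V *v c))\<^sup>2)) \<partial>lborel)
      = ennreal (Gamma (real CARD('n) / 2 + 1) * measure lborel {c \<in> orthant. (norm (V *v c))\<^sup>2 \<le> 1})"
    by (subst nn_integral_exp_quadratic_cone)
      (auto simp: ennreal_mult' Gamma_real_nonneg matrix_vector_mult_scaleR power_mult_distrib)
qed (auto intro!: AE_I2 Gamma_real_nonneg mult_nonneg_nonneg)

text \<open>The part of the cone in the unit ball is the image of \<open>K\<close>, whose volume
  also determines the Gaussian integral. The Gamma value there is the one in the volume of the unit
  ball, so it cancels in the quotient.\<close>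

lemma solid_angle_gen_cone:
  fixes v :: "'n::finite \<Rightarrow> real ^ 'n" and V :: "real ^ 'n ^ 'n"
  assumes V: "\<And>j. column j V = v j" and inj: "inj ((*v) V)"
  shows "solid_angle (gen_cone v)
    = \<bar>det V\<bar> / pi powr (real CARD('n) / 2)
      * (\<integral>c. indicator orthant c * exp (- (norm (V *v c))\<^sup>2) \<partial>lborel)"
proof -
  define K where "K = {c \<in> orthant. (norm (V *v c))\<^sup>2 \<le> 1}"
  have K: "compact K"
    unfolding K_def using inj by (rule compact_orthant_unit)
  have img: "gen_cone v = (*v) V ` orthant"
    using V by (rule gen_cone_eq_image)
  have "gen_cone v \<inter> cball 0 1 = (*v) V ` K"
    by (auto simp: img K_def power_le_one_iff abs_square_le_1)
  then have "measure lebesgue (gen_cone v \<inter> cball 0 1) = measure lborel ((*v) V ` K)"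
    using compact_matrix_image[OF K, of V] by (simp add: compact_imp_closed borel_closed)
  also have "\<dots> = \<bar>det V\<bar> * measure lborel K"
    using K by (rule measure_matrix_image)
  finally have num: "measure lebesgue (gen_cone v \<inter> cball 0 1) = \<bar>det V\<bar> * measure lborel K" .
  have "sphere_vol (gen_cone v \<inter> sphere 0 1)
      = real CARD('n) * measure lebesgue (gen_cone v \<inter> cball 0 1)"
  proof -
    have "sphere_vol (gen_cone v \<inter> sphere 0 1)
      = real DIM(real^'n) * measure lebesgue (gen_cone v \<inter> cball 0 1)"
    proof (rule sphere_vol_cone)
      \<comment> \<open>The sum of all generators serves as the nonzero point of the cone.\<close>
      show "V *v (\<chi> i. 1) \<in> gen_cone v"
        unfolding img by (intro imageI) simp
      have "(\<chi> i. 1) \<noteq> (0 :: real^'n)"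
        by (simp add: vec_eq_iff)
      then show "V *v (\<chi> i. 1) \<noteq> 0"
        using injD[OF inj, of "\<chi> i. 1" 0] by auto
      show "t *\<^sub>R x \<in> gen_cone v" if "0 \<le> t" "x \<in> gen_cone v" for t x
      proof -
        obtain c where c: "x = V *v c" "c \<in> orthant"
          using \<open>x \<in> gen_cone v\<close> unfolding img by blast
        then have "t *\<^sub>R x = V *v (t *\<^sub>R c)" "t *\<^sub>R c \<in> orthant"
          using \<open>0 \<le> t\<close> by (auto simp: matrix_vector_mult_scaleR)
        then show ?thesis
          unfolding img by blast
      qed
    qed
    then show ?thesis by simp
  qed
  \<comment> \<open>The whole space is itself a cone, and any unit vector is a nonzero point of
    it.\<close>
  moreover have "sphere_vol (sphere (0::real^'n) 1)
      = real CARD('n) * (pi powr (real CARD('n) / 2) / Gamma (real CARD('n) / 2 + 1))"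
    using sphere_vol_cone[of "UNIV :: (real^'n) set" "axis undefined 1"]
    by (simp add: content_cball unit_ball_vol_def axis_eq_0_iff)
  moreover have "(\<integral>c. indicator orthant c * exp (- (norm (V *v c))\<^sup>2) \<partial>lborel)
      = Gamma (real CARD('n) / 2 + 1) * measure lborel K"
    using has_bochner_integral_orthant_gaussian[OF inj] unfolding K_def
    by (rule has_bochner_integral_integral_eq)
  ultimately show ?thesis
    by (simp add: solid_angle_def num)
qed

section \<open>Termwise integration\<close>

text \<open>Leaves the infix to the notion defined by integrability over the counting measure, to
  which Fubini's theorem applies.\<close>

no_notation Infinite_Sum.abs_summable_on (infixr \<open>abs'_summable'_on\<close> 46)

lemma nn_integral_lborel_prod_cart:
  fixes f :: "'n::finite \<Rightarrow> real \<Rightarrow> ennreal"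
  assumes [measurable]: "\<And>i. f i \<in> borel_measurable borel"
  shows "(\<integral>\<^sup>+(x::real^'n). (\<Prod>i\<in>UNIV. f i (x $ i)) \<partial>lborel) = (\<Prod>i\<in>UNIV. (\<integral>\<^sup>+t. f i t \<partial>lborel))"
proof -
  have Basis: "(Basis :: (real^'n) set) = (\<lambda>i. axis i 1) ` UNIV"
    by (auto simp: Basis_vec_def)
  have prod: "(\<Prod>b\<in>(Basis :: (real^'n) set). g b) = (\<Prod>i\<in>UNIV. g (axis i 1))" for g :: "real^'n \<Rightarrow> ennreal"
    unfolding Basis by (subst prod.reindex) (auto simp: inj_on_def axis_eq_axis)
  have index: "axis_index (axis i 1 :: real^'n) = i" for i
    by (simp add: axis_index_def axis_eq_axis)
  show ?thesis
    using nn_integral_lborel_prod[where f = "\<lambda>b::real^'n. f (axis_index b)"]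
    by (simp add: prod index inner_axis)
qed

lemma multi_indices_outside:
  assumes "b \<in> multi_indices n" "i = 0 \<or> n \<le> i"
  shows "b i = 0"
  using assms by (auto simp: multi_indices_def)

text \<open>Exchanges the default value outside \<open>{1..<n}\<close>: \<open>0\<close> for
  multi-indices, \<open>undefined\<close> for the extensional functions in the rules on sums of
  products.\<close>

lemma bij_betw_multi_indices:
  "bij_betw (\<lambda>b. restrict b {1..<n}) (multi_indices n) (PiE {1..<n} (\<lambda>_. UNIV))"
proof (rule bij_betwI[where g = "\<lambda>b i. if i \<in> {1..<n} then b i else 0"])
  show "(\<lambda>b i. if i \<in> {1..<n} then b i else 0) (restrict b {1..<n}) = b"
    if "b \<in> multi_indices n" for b
    using that by (auto simp: multi_indices_def fun_eq_iff)
  show "restrict ((\<lambda>b i. if i \<in> {1..<n} then b i else 0) b) {1..<n} = b"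
    if "b \<in> PiE {1..<n} (\<lambda>_. UNIV)" for b
    using that by (auto simp: fun_eq_iff PiE_def extensional_def)
qed (auto simp: multi_indices_def)

lemma countable_multi_indices: "countable (multi_indices n)"
proof -
  have "countable (PiE {1..<n} (\<lambda>_. UNIV :: nat set))"
    by (intro countable_PiE) auto
  then show ?thesis
    using bij_betw_multi_indices[of n] by (metis countable_image_inj_on bij_betw_def)
qed

text \<open>Multiplies out finitely many exponential series, each of which converges
  absolutely.\<close>

lemma exp_multi_series:
  fixes z :: "nat \<Rightarrow> real"
  shows "(\<lambda>b. \<Prod>k\<in>{1..<n}. z k ^ b k / fact (b k)) abs_summable_on multi_indices n"
    and "infsetsum (\<lambda>b. \<Prod>k\<in>{1..<n}. z k ^ b k / fact (b k)) (multi_indices n)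
      = exp (\<Sum>k\<in>{1..<n}. z k)"
proof -
  define g where "g = (\<lambda>k m. z k ^ m / fact m)"
  have summable: "g k abs_summable_on UNIV" for k
    using summable_exp[of "\<bar>z k\<bar>"]
    by (simp add: abs_summable_on_nat_iff' g_def abs_mult power_abs divide_inverse mult.commute)
  have exp: "infsetsum (g k) UNIV = exp (z k)" for k
    using summable[of k] by (subst infsetsum_nat') (auto simp: g_def exp_def scaleR_conv_of_real divide_inverse mult.commute)
  have eq: "(\<Prod>k\<in>{1..<n}. z k ^ b k / fact (b k))
      = (\<Prod>k\<in>{1..<n}. g k (restrict b {1..<n} k))" for b
    by (intro prod.cong) (auto simp: g_def)
  show "(\<lambda>b. \<Prod>k\<in>{1..<n}. z k ^ b k / fact (b k)) abs_summable_on multi_indices n"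
    unfolding eq abs_summable_on_reindex_bij_betw[OF bij_betw_multi_indices,
        where f = "\<lambda>b. \<Prod>k\<in>{1..<n}. g k (b k)"]
    by (intro abs_summable_on_prod_PiE summable) auto
  show "infsetsum (\<lambda>b. \<Prod>k\<in>{1..<n}. z k ^ b k / fact (b k)) (multi_indices n)
      = exp (\<Sum>k\<in>{1..<n}. z k)"
    unfolding eq infsetsum_reindex_bij_betw[OF bij_betw_multi_indices,
        where f = "\<lambda>b. \<Prod>k\<in>{1..<n}. g k (b k)"]
    by (subst infsetsum_prod_PiE) (auto intro: summable simp: exp exp_sum)
qed

text \<open>The factor \<open>x i\<close> occurs on the left only for \<open>k = i - 1\<close> and
  \<open>k = i\<close>; the zero values of \<open>b\<close> at both ends account for the missing
  neighbours. This is where the arguments of the Gamma factors come from.\<close>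

lemma prod_adjacent_powers:
  fixes x :: "nat \<Rightarrow> 'a::comm_monoid_mult"
  assumes "b 0 = 0" "b n = 0"
  shows "(\<Prod>k\<in>{1..<n}. (x k * x (k + 1)) ^ b k) = (\<Prod>i\<in>{1..n}. x i ^ (b (i - 1) + b i))"
proof (cases "n = 0")
  case False
  have "(\<Prod>i\<in>{1..n}. x i ^ b i) = (\<Prod>i\<in>{1..<n}. x i ^ b i)"
    using assms False by (intro prod.mono_neutral_right) (auto simp: not_less le_less)
  moreover have "(\<Prod>i\<in>{1..n}. x i ^ b (i - 1)) = (\<Prod>k\<in>{1..<n}. x (k + 1) ^ b k)"
  proof -
    have "(\<Prod>i\<in>{1..n}. x i ^ b (i - 1)) = (\<Prod>k\<in>{0..<n}. x (k + 1) ^ b k)"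
      by (rule prod.reindex_bij_witness[of _ Suc "\<lambda>i. i - 1"]) auto
    also have "\<dots> = (\<Prod>k\<in>{1..<n}. x (k + 1) ^ b k)"
      using assms by (intro prod.mono_neutral_right) (auto simp: Suc_le_eq)
    finally show ?thesis .
  qed
  ultimately show ?thesis
    by (simp add: power_add power_mult_distrib prod.distrib mult.commute)
qed simp

text \<open>The integrand is a product over the coordinates, so the integral is a product of
  half-line moments, each contributing a factor \<open>1 / 2\<close>.\<close>

lemma integral_orthant_gaussian_monomial:
  fixes m :: "'n::finite \<Rightarrow> nat"
  shows "(\<integral>(c::real^'n). indicator orthant c * exp (- (norm c)\<^sup>2) * (\<Prod>i\<in>UNIV. (c $ i) ^ m i) \<partial>lborel)
    = (\<Prod>i\<in>UNIV. Gamma ((1 + real (m i)) / 2)) / 2 ^ CARD('n)"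
proof -
  have eq: "indicator orthant c * exp (- (norm c)\<^sup>2) * (\<Prod>i\<in>UNIV. (c $ i) ^ m i)
      = (\<Prod>i\<in>UNIV. indicator {0..} (c $ i) * (c $ i) ^ m i * exp (- (c $ i)\<^sup>2))" for c :: "real^'n"
  proof -
    have "(norm c)\<^sup>2 = (\<Sum>i\<in>UNIV. (c $ i)\<^sup>2)"
      unfolding power2_norm_eq_inner by (simp add: inner_vec_def power2_eq_square)
    moreover have "indicator orthant c = (\<Prod>i\<in>UNIV. indicator {0..} (c $ i) :: real)"
      by (auto simp: indicator_def)
    ultimately show ?thesis
      by (simp add: prod.distrib exp_sum sum_negf[symmetric] mult_ac)
  qed
  have "(\<integral>\<^sup>+(c::real^'n). ennreal (indicator orthant c * exp (- (norm c)\<^sup>2) * (\<Prod>i\<in>UNIV. (c $ i) ^ m i)) \<partial>lborel)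
      = (\<integral>\<^sup>+(c::real^'n). (\<Prod>i\<in>UNIV. ennreal (indicator {0..} (c $ i) * (c $ i) ^ m i * exp (- (c $ i)\<^sup>2))) \<partial>lborel)"
    unfolding eq by (intro nn_integral_cong prod_ennreal[symmetric]) (auto split: split_indicator)
  also have "\<dots> = (\<Prod>i\<in>UNIV. ennreal (Gamma ((1 + real (m i)) / 2) / 2))"
    by (subst nn_integral_lborel_prod_cart) (simp_all add: nn_integral_half_gaussian_moment)
  also have "\<dots> = ennreal (\<Prod>i\<in>UNIV. Gamma ((1 + real (m i)) / 2) / 2)"
    by (intro prod_ennreal) (auto intro!: Gamma_real_nonneg divide_nonneg_nonneg)
  finally have nn: "(\<integral>\<^sup>+(c::real^'n). ennreal (indicator orthant c * exp (- (norm c)\<^sup>2) * (\<Prod>i\<in>UNIV. (c $ i) ^ m i)) \<partial>lborel)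
    = ennreal (\<Prod>i\<in>UNIV. Gamma ((1 + real (m i)) / 2) / 2)" .
  have "has_bochner_integral lborel
      (\<lambda>c::real^'n. indicator orthant c * exp (- (norm c)\<^sup>2) * (\<Prod>i\<in>UNIV. (c $ i) ^ m i))
      (\<Prod>i\<in>UNIV. Gamma ((1 + real (m i)) / 2) / 2)"
  proof (rule has_bochner_integral_nn_integral[OF _ _ _ nn])
    have [measurable]: "(orthant :: (real^'n) set) \<in> sets borel"
      using closed_orthant by (rule borel_closed)
    show "(\<lambda>c::real^'n. indicator orthant c * exp (- (norm c)\<^sup>2) * (\<Prod>i\<in>UNIV. (c $ i) ^ m i))
        \<in> borel_measurable lborel"
      by measurable
    show "AE (c::real^'n) in lborel.
        0 \<le> indicator orthant c * exp (- (norm c)\<^sup>2) * (\<Prod>i\<in>UNIV. (c $ i) ^ m i)"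
      unfolding eq by (intro AE_I2 prod_nonneg) (auto split: split_indicator)
    show "0 \<le> (\<Prod>i\<in>UNIV. Gamma ((1 + real (m i)) / 2) / 2)"
      by (intro prod_nonneg) (auto intro!: Gamma_real_nonneg)
  qed
  then show ?thesis
    by (simp add: has_bochner_integral_integral_eq prod_dividef)
qed

section \<open>Series expansion for Gaussians with coupling between neighbouring coordinates\<close>

context
  fixes pos :: "nat \<Rightarrow> 'n::finite"
  assumes pos: "bij_betw pos {1..CARD('n)} UNIV"
begin

text \<open>Half of the off-diagonal part of the quadratic form of a symmetric tridiagonal matrix
  whose entries beside the diagonal are \<open>\<gamma> k\<close>.\<close>

definition chain_form :: "(nat \<Rightarrow> real) \<Rightarrow> real ^ 'n \<Rightarrow> real" where
  "chain_form \<gamma> c = (\<Sum>k\<in>{1..<CARD('n)}. \<gamma> k * (c $ pos k * c $ pos (k + 1)))"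

text \<open>The term of index \<open>b\<close> when \<open>exp (- 2 * chain_form \<gamma> c)\<close>
  is expanded into a power series under the Gaussian on the orthant.\<close>

definition chain_integrand :: "(nat \<Rightarrow> real) \<Rightarrow> real ^ 'n \<Rightarrow> (nat \<Rightarrow> nat) \<Rightarrow> real" where
  "chain_integrand \<gamma> c b = indicator orthant c * exp (- (norm c)\<^sup>2)
    * (\<Prod>k\<in>{1..<CARD('n)}. (- 2 * \<gamma> k * (c $ pos k * c $ pos (k + 1))) ^ b k / fact (b k))"

lemma integral_chain_integrand:
  assumes b: "b \<in> multi_indices CARD('n)"
  shows "(\<integral>c. chain_integrand \<gamma> c b \<partial>lborel) = angle_term CARD('n) \<gamma> b / 2 ^ CARD('n)"
proof -
  \<comment> \<open>\<open>m j\<close> is the exponent of the coordinate \<open>j\<close> in the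
    monomial, read off at its position in the chain.\<close>
  define m where "m j = b (the_inv_into {1..CARD('n)} pos j - 1) + b (the_inv_into {1..CARD('n)} pos j)" for j
  have m: "m (pos i) = b (i - 1) + b i" if "i \<in> {1..CARD('n)}" for i
    using pos that by (simp add: m_def the_inv_into_f_f bij_betw_def)
  \<comment> \<open>\<open>A\<close> collects everything that does not depend on
    \<open>c\<close>.\<close>
  define A where "A = (-2) ^ (\<Sum>i\<in>{1..<CARD('n)}. b i) / (\<Prod>i\<in>{1..<CARD('n)}. fact (b i))
    * (\<Prod>i\<in>{1..<CARD('n)}. \<gamma> i ^ b i)"
  have "(\<Prod>k\<in>{1..<CARD('n)}. (- 2 * \<gamma> k * (c $ pos k * c $ pos (k + 1))) ^ b k / fact (b k))
      = A * (\<Prod>j\<in>UNIV. (c $ j) ^ m j)" for c :: "real^'n"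
  proof -
    have "(\<Prod>j\<in>UNIV. (c $ j) ^ m j) = (\<Prod>i\<in>{1..CARD('n)}. (c $ pos i) ^ m (pos i))"
      using prod.reindex_bij_betw[OF pos, of "\<lambda>j. (c $ j) ^ m j"] by simp
    also have "\<dots> = (\<Prod>i\<in>{1..CARD('n)}. (c $ pos i) ^ (b (i - 1) + b i))"
      by (intro prod.cong) (simp_all add: m)
    also have "\<dots> = (\<Prod>k\<in>{1..<CARD('n)}. (c $ pos k * c $ pos (k + 1)) ^ b k)"
      using b by (intro prod_adjacent_powers[symmetric]) (auto intro: multi_indices_outside)
    finally have P: "(\<Prod>j\<in>UNIV. (c $ j) ^ m j) = (\<Prod>k\<in>{1..<CARD('n)}. (c $ pos k * c $ pos (k + 1)) ^ b k)" .
    show ?thesis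
      unfolding P A_def by (simp only: power_mult_distrib prod.distrib prod_dividef power_sum) simp
  qed
  then have "chain_integrand \<gamma> c b
      = A * (indicator orthant c * exp (- (norm c)\<^sup>2) * (\<Prod>j\<in>UNIV. (c $ j) ^ m j))" for c
    by (simp add: chain_integrand_def mult_ac)
  then have "(\<integral>c. chain_integrand \<gamma> c b \<partial>lborel)
      = A * ((\<Prod>j\<in>UNIV. Gamma ((1 + real (m j)) / 2)) / 2 ^ CARD('n))"
    by (simp only: integral_mult_right_zero integral_orthant_gaussian_monomial)
  also have "(\<Prod>j\<in>UNIV. Gamma ((1 + real (m j)) / 2))
      = (\<Prod>i\<in>{1..CARD('n)}. Gamma ((1 + real (m (pos i))) / 2))"
    using prod.reindex_bij_betw[OF pos, of "\<lambda>j. Gamma ((1 + real (m j)) / 2)"] by simp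
  also have "\<dots> = (\<Prod>i\<in>{1..CARD('n)}. Gamma ((1 + real (b (i - 1)) + real (b i)) / 2))"
    by (intro prod.cong) (simp_all add: m add.assoc)
  finally show ?thesis
    by (simp add: angle_term_def A_def)
qed

text \<open>On the orthant all coordinates are nonnegative, so taking absolute values of the terms
  amounts to replacing \<open>\<gamma> k\<close> by \<open>- \<bar>\<gamma> k\<bar>\<close>. The
  third sum is thus an instance of the second, which is proved for all coefficients.\<close>

lemma chain_integrand_sums:
  shows "chain_integrand \<gamma> c abs_summable_on multi_indices CARD('n)"
    and "infsetsum (chain_integrand \<gamma> c) (multi_indices CARD('n))
      = indicator orthant c * exp (- ((norm c)\<^sup>2 + 2 * chain_form \<gamma> c))"
    and "infsetsum (\<lambda>b. norm (chain_integrand \<gamma> c b)) (multi_indices CARD('n))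
      = indicator orthant c * exp (- ((norm c)\<^sup>2 + 2 * chain_form (\<lambda>k. - \<bar>\<gamma> k\<bar>) c))"
proof -
  have eq: "chain_integrand \<gamma> c = (\<lambda>b. indicator orthant c * exp (- (norm c)\<^sup>2) *
      (\<Prod>k\<in>{1..<CARD('n)}. (- 2 * \<gamma> k * (c $ pos k * c $ pos (k + 1))) ^ b k / fact (b k)))" for \<gamma> c
    by (simp add: chain_integrand_def fun_eq_iff)
  show "chain_integrand \<gamma> c abs_summable_on multi_indices CARD('n)" for \<gamma>
    unfolding eq by (intro abs_summable_on_cmult_right exp_multi_series)
  show sum: "infsetsum (chain_integrand \<gamma> c) (multi_indices CARD('n))
      = indicator orthant c * exp (- ((norm c)\<^sup>2 + 2 * chain_form \<gamma> c))" for \<gamma>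
    unfolding eq by (subst infsetsum_cmult_right)
      (simp_all only: exp_multi_series chain_form_def mult.assoc exp_add[symmetric],
        simp add: sum_distrib_left sum_negf mult.assoc)
  have "(\<lambda>b. norm (chain_integrand \<gamma> c b)) = chain_integrand (\<lambda>k. - \<bar>\<gamma> k\<bar>) c"
    by (auto simp: chain_integrand_def fun_eq_iff abs_mult abs_prod power_abs split: split_indicator
        intro!: prod.cong)
  then show "infsetsum (\<lambda>b. norm (chain_integrand \<gamma> c b)) (multi_indices CARD('n))
      = indicator orthant c * exp (- ((norm c)\<^sup>2 + 2 * chain_form (\<lambda>k. - \<bar>\<gamma> k\<bar>) c))"
    by (simp only: sum)
qed

text \<open>Fubini for Lebesgue measure times the counting measure on multi-indices. The hypothesis
  says that the sum of the absolute values of the terms is integrable in \<open>c\<close>.\<close>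

lemma angle_term_series:
  assumes "integrable lborel
    (\<lambda>c. indicator orthant c * exp (- ((norm c)\<^sup>2 + 2 * chain_form (\<lambda>k. - \<bar>\<gamma> k\<bar>) c)))"
  shows "angle_term CARD('n) \<gamma> abs_summable_on multi_indices CARD('n)"
    and "infsetsum (angle_term CARD('n) \<gamma>) (multi_indices CARD('n)) = 2 ^ CARD('n) *
      (\<integral>c. indicator orthant c * exp (- ((norm c)\<^sup>2 + 2 * chain_form \<gamma> c)) \<partial>lborel)"
proof -
  define P where "P = multi_indices CARD('n)"
  interpret P: sigma_finite_measure "count_space P"
    unfolding P_def by (intro sigma_finite_measure_count_space_countable countable_multi_indices)
  interpret pair_sigma_finite "lborel :: (real^'n) measure" "count_space P" ..
  have [measurable]: "(orthant :: (real^'n) set) \<in> sets borel"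
    using closed_orthant by (rule borel_closed)
  have [measurable]: "(\<lambda>c. chain_integrand \<gamma> c b) \<in> borel_measurable borel" for b
    unfolding chain_integrand_def by measurable
  \<comment> \<open>There are countably many multi-indices, so measurability for each fixed one
    suffices.\<close>
  have meas: "case_prod (chain_integrand \<gamma>) \<in> borel_measurable (lborel \<Otimes>\<^sub>M count_space P)"
  proof -
    have "(\<lambda>p. chain_integrand \<gamma> (fst p) (snd p)) \<in> borel_measurable (lborel \<Otimes>\<^sub>M count_space P)"
      by (rule measurable_compose_countable'[where f = "\<lambda>b p. chain_integrand \<gamma> (fst p) b" and g = snd and I = P])
        (auto simp: P_def countable_multi_indices)
    then show ?thesis
      by (simp add: case_prod_unfold)
  qed
  have prod: "integrable (lborel \<Otimes>\<^sub>M count_space P) (case_prod (chain_integrand \<gamma>))"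
  proof (rule Fubini_integrable[OF meas])
    show "integrable lborel (\<lambda>c. \<integral>b. norm (case_prod (chain_integrand \<gamma>) (c, b)) \<partial>count_space P)"
      using assms chain_integrand_sums(3) by (simp add: P_def infsetsum_def)
    show "AE c in lborel. integrable (count_space P) (\<lambda>b. case_prod (chain_integrand \<gamma>) (c, b))"
      using chain_integrand_sums(1) by (simp add: P_def abs_summable_on_def)
  qed
  \<comment> \<open>Absolute convergence also comes from Fubini: the integral over \<open>c\<close>
    is an integrable function of \<open>b\<close>.\<close>
  have "integrable (count_space P) (\<lambda>b. angle_term CARD('n) \<gamma> b / 2 ^ CARD('n))"
    using integrable_snd[OF prod]
    by (rule Bochner_Integration.integrable_cong[THEN iffD1, rotated 2])
      (auto simp: P_def integral_chain_integrand)
  then have "integrable (count_space P) (\<lambda>b. 2 ^ CARD('n) * (angle_term CARD('n) \<gamma> b / 2 ^ CARD('n)))"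
    by (rule integrable_mult_right)
  then show "angle_term CARD('n) \<gamma> abs_summable_on multi_indices CARD('n)"
    by (simp add: abs_summable_on_def P_def)
  have "(\<integral>b. angle_term CARD('n) \<gamma> b / 2 ^ CARD('n) \<partial>count_space P)
      = (\<integral>b. (\<integral>c. chain_integrand \<gamma> c b \<partial>lborel) \<partial>count_space P)"
    by (intro Bochner_Integration.integral_cong) (auto simp: P_def integral_chain_integrand)
  also have "\<dots> = (\<integral>c. (\<integral>b. chain_integrand \<gamma> c b \<partial>count_space P) \<partial>lborel)"
    using prod by (rule Fubini_integral)
  also have "\<dots> = (\<integral>c. indicator orthant c * exp (- ((norm c)\<^sup>2 + 2 * chain_form \<gamma> c)) \<partial>lborel)"
    using chain_integrand_sums(2) by (simp add: P_def infsetsum_def)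
  finally show "infsetsum (angle_term CARD('n) \<gamma>) (multi_indices CARD('n)) = 2 ^ CARD('n) *
      (\<integral>c. indicator orthant c * exp (- ((norm c)\<^sup>2 + 2 * chain_form \<gamma> c)) \<partial>lborel)"
    by (simp add: infsetsum_def P_def field_simps)
qed

end

section \<open>Tridiagonal Gram matrices\<close>

text \<open>Induction on the size: of the new row and column only the corner and the two entries
  beside the diagonal survive.\<close>

lemma sum_tridiagonal:
  fixes a :: "nat \<Rightarrow> nat \<Rightarrow> 'a::comm_monoid_add"
  assumes "\<And>i j. i \<in> {1..n} \<Longrightarrow> j \<in> {1..n} \<Longrightarrow> \<bar>int i - int j\<bar> \<ge> 2 \<Longrightarrow> a i j = 0"
  shows "(\<Sum>i\<in>{1..n}. \<Sum>j\<in>{1..n}. a i j)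
    = (\<Sum>i\<in>{1..n}. a i i) + (\<Sum>k\<in>{1..<n}. a k (k + 1) + a (k + 1) k)"
  using assms
proof (induction n)
  case (Suc n)
  show ?case
  proof (cases "n = 0")
    case False
    have col: "(\<Sum>i\<in>{1..n}. a i (Suc n)) = a n (Suc n)"
      using False Suc.prems by (subst sum.remove[of _ n]) (auto intro!: sum.neutral)
    have row: "(\<Sum>j\<in>{1..n}. a (Suc n) j) = a (Suc n) n"
      using False Suc.prems by (subst sum.remove[of _ n]) (auto intro!: sum.neutral)
    have "(\<Sum>i\<in>{1..n}. \<Sum>j\<in>{1..n}. a i j)
      = (\<Sum>i\<in>{1..n}. a i i) + (\<Sum>k\<in>{1..<n}. a k (k + 1) + a (k + 1) k)"
      using Suc.prems by (intro Suc.IH) auto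
    moreover have "{1..<Suc n} = insert n {1..<n}"
      using False by auto
    ultimately show ?thesis
      using col row by (simp add: sum.distrib ac_simps)
  qed simp
qed simp

text \<open>The unit diagonal yields the squared norm, and symmetry merges the two entries that
  couple neighbours, hence the factor \<open>2\<close>.\<close>

lemma quadratic_form_tridiagonal:
  fixes A :: "real ^ 'n::finite ^ 'n" and pos :: "nat \<Rightarrow> 'n"
  assumes pos: "bij_betw pos {1..CARD('n)} UNIV"
    and diag: "\<And>i. A $ i $ i = 1"
    and sym: "transpose A = A"
    and tridiag: "\<And>i j. i \<in> {1..CARD('n)} \<Longrightarrow> j \<in> {1..CARD('n)} \<Longrightarrow>
      \<bar>int i - int j\<bar> \<ge> 2 \<Longrightarrow> A $ pos i $ pos j = 0"
    and off: "\<And>i. i \<in> {1..<CARD('n)} \<Longrightarrow> A $ pos i $ pos (i + 1) = \<gamma> i"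
  shows "c \<bullet> (A *v c) = (norm c)\<^sup>2 + 2 * chain_form pos \<gamma> c"
proof -
  have reindex: "(\<Sum>i\<in>UNIV. f i) = (\<Sum>i\<in>{1..CARD('n)}. f (pos i))" for f :: "'n \<Rightarrow> real"
    using sum.reindex_bij_betw[OF pos, of f] by simp
  have sym': "A $ i $ j = A $ j $ i" for i j
    using arg_cong[OF sym, of "\<lambda>B. B $ i $ j"] by (simp add: transpose_def)
  have "c \<bullet> (A *v c) = (\<Sum>i\<in>{1..CARD('n)}. \<Sum>j\<in>{1..CARD('n)}.
      c $ pos i * (A $ pos i $ pos j * c $ pos j))"
    by (simp only: inner_vec_def matrix_vector_mult_def vec_lambda_beta inner_real_def
        reindex sum_distrib_left)
  also have "\<dots> = (\<Sum>i\<in>{1..CARD('n)}. c $ pos i * (A $ pos i $ pos i * c $ pos i))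
      + (\<Sum>k\<in>{1..<CARD('n)}. c $ pos k * (A $ pos k $ pos (k + 1) * c $ pos (k + 1))
        + c $ pos (k + 1) * (A $ pos (k + 1) $ pos k * c $ pos k))"
    by (rule sum_tridiagonal) (simp add: tridiag)
  also have "(\<Sum>i\<in>{1..CARD('n)}. c $ pos i * (A $ pos i $ pos i * c $ pos i)) = (norm c)\<^sup>2"
    unfolding power2_norm_eq_inner inner_vec_def reindex by (simp add: diag)
  also have "(\<Sum>k\<in>{1..<CARD('n)}. c $ pos k * (A $ pos k $ pos (k + 1) * c $ pos (k + 1))
        + c $ pos (k + 1) * (A $ pos (k + 1) $ pos k * c $ pos k)) = 2 * chain_form pos \<gamma> c"
    unfolding chain_form_def[OF pos] sum_distrib_left
  proof (rule sum.cong)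
    fix k assume "k \<in> {1..<CARD('n)}"
    then show "c $ pos k * (A $ pos k $ pos (k + 1) * c $ pos (k + 1))
        + c $ pos (k + 1) * (A $ pos (k + 1) $ pos k * c $ pos k)
      = 2 * (\<gamma> k * (c $ pos k * c $ pos (k + 1)))"
      using off[of k] sym'[of "pos (k + 1)" "pos k"] by simp
  qed simp
  finally show ?thesis .
qed

text \<open>The signs are chosen one after another along the chain: \<open>t\<close> flips between
  \<open>k\<close> and \<open>k + 1\<close> exactly when \<open>\<beta> k \<ge> 0\<close>. No choice
  conflicts with an earlier one, since a path has no cycle.\<close>

lemma alternating_signs:
  fixes \<beta> :: "nat \<Rightarrow> real"
  obtains t :: "nat \<Rightarrow> real" where "\<And>k. t k * t k = 1" "\<And>k. t k * t (k + 1) * \<beta> k = - \<bar>\<beta> k\<bar>"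
proof
  define t :: "nat \<Rightarrow> real" where "t k = (\<Prod>j<k. if 0 \<le> \<beta> j then -1 else 1)" for k
  show sq: "t k * t k = 1" for k
    unfolding t_def prod.distrib[symmetric] by (intro prod.neutral) auto
  have "t k * t (k + 1) = (t k * t k) * (if 0 \<le> \<beta> k then -1 else 1)" for k
    by (simp add: t_def)
  then show "t k * t (k + 1) * \<beta> k = - \<bar>\<beta> k\<bar>" for k
    by (simp add: sq)
qed

lemma inner_gram:
  fixes V :: "real ^ 'n::finite ^ 'm::finite"
  shows "c \<bullet> ((transpose V ** V) *v c) = (norm (V *v c))\<^sup>2"
  by (simp add: matrix_vector_mul_assoc[symmetric] dot_lmul_matrix[symmetric] power2_norm_eq_inner
      vector_transpose_matrix)
    (rule inner_commute)

text \<open>A kernel vector is a vanishing combination of the columns. Injectivity of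
  \<open>v\<close> allows its coefficients to be indexed by the vectors themselves, as independence
  of a set demands.\<close>

lemma inj_matrix_of_independent_columns:
  fixes V :: "real ^ 'n::finite ^ 'm::finite"
  assumes V: "\<And>j. column j V = v j" and inj: "inj v" and indep: "independent (range v)"
  shows "inj ((*v) V)"
proof -
  have "x = 0" if "V *v x = 0" for x
  proof -
    have "(\<Sum>w\<in>range v. x $ inv v w *\<^sub>R w) = (\<Sum>i\<in>UNIV. x $ i *\<^sub>R v i)"
      using inj by (simp add: sum.reindex)
    also have "\<dots> = 0"
      using that by (simp add: matrix_mult_sum scalar_mult_eq_scaleR V)
    finally have "x $ inv v (v i) = 0" for i
      by (intro independentD[OF indep, of "range v" "\<lambda>w. x $ inv v w"]) auto
    then show ?thesis
      using inj by (simp add: vec_eq_iff)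
  qed
  then show ?thesis
    by (simp add: linear_injective_0)
qed

theorem theorem4p1:
  fixes v :: "'n::finite \<Rightarrow> real ^ 'n"
    and pos :: "nat \<Rightarrow> 'n"
    and V :: "real ^ 'n ^ 'n"
    and \<beta> :: "nat \<Rightarrow> real"
  assumes pos: "bij_betw pos {1..CARD('n)} UNIV"
    and unit: "\<And>i. norm (v i) = 1"
    and indep: "inj v" "independent (range v)"
    and V: "\<And>j. column j V = v j"
    and tridiag: "\<And>i j. i \<in> {1..CARD('n)} \<Longrightarrow> j \<in> {1..CARD('n)} \<Longrightarrow>
      \<bar>int i - int j\<bar> \<ge> 2 \<Longrightarrow> (transpose V ** V) $ pos i $ pos j = 0"
    and \<beta>: "\<And>i. i \<in> {1..<CARD('n)} \<Longrightarrow> \<beta> i = v (pos i) \<bullet> v (pos (i + 1))"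
  shows "eigenvalues (assoc_matrix v) = eigenvalues (transpose V ** V) \<and>
    (\<forall>\<mu>. dim (eigenspace (assoc_matrix v) \<mu>) = dim (eigenspace (transpose V ** V) \<mu>)) \<and>
    positive_definite (assoc_matrix v) \<and>
    (\<lambda>b. \<bar>angle_term CARD('n) \<beta> b\<bar>) summable_on multi_indices CARD('n) \<and>
    angle_series V \<beta> = solid_angle (gen_cone v)"
proof -
  define n where "n = CARD('n)"
  define G where "G = transpose V ** V"
  define M where "M = assoc_matrix v"
  note [simp] = n_def[symmetric]
  have G: "G $ i $ j = v i \<bullet> v j" for i j
    by (simp add: G_def matrix_matrix_mult_def transpose_def inner_vec_def column_def V[symmetric])
  have M: "M $ i $ j = (if i = j then 1 else - \<bar>G $ i $ j\<bar>)" for i j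
    by (simp add: M_def assoc_matrix_def G)
  have diag: "G $ i $ i = 1" for i
    using unit[of i] by (simp add: G dot_square_norm)
  have symG: "transpose G = G"
    by (simp add: vec_eq_iff transpose_def G inner_commute)
  have symM: "transpose M = M"
    by (simp add: vec_eq_iff transpose_def M G inner_commute)
  have inj: "inj ((*v) V)"
    using V indep by (rule inj_matrix_of_independent_columns)
  obtain t where t: "\<And>k. t k * t k = 1" "\<And>k. t k * t (k + 1) * \<beta> k = - \<bar>\<beta> k\<bar>"
    using alternating_signs[of \<beta>] by blast
  \<comment> \<open>\<open>s\<close> carries the signs from positions in the chain to
    coordinates.\<close>
  define s where "s i = t (the_inv_into {1..n} pos i)" for i
  have s_pos: "s (pos k) = t k" if "k \<in> {1..n}" for k
    using pos that by (simp add: s_def the_inv_into_f_f bij_betw_def)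
  have ss: "s i * s i = 1" for i
    by (simp add: s_def t)
  have next_entry: "s (pos k) * s (pos (k + 1)) * G $ pos k $ pos (k + 1) = - \<bar>G $ pos k $ pos (k + 1)\<bar>"
    if "k \<in> {1..<n}" for k
    using that \<beta>[of k] t(2)[of k] by (simp add: s_pos G)
  have pos_eq: "pos p = pos q \<longleftrightarrow> p = q" if "p \<in> {1..n}" "q \<in> {1..n}" for p q
    using inj_on_eq_iff[OF bij_betw_imp_inj_on[OF pos]] that by simp
  \<comment> \<open>The signs square to \<open>1\<close> on the diagonal, the distant entries
    vanish, and the neighbouring ones are right by the choice of \<open>t\<close>.\<close>
  have "M $ pos p $ pos q = s (pos p) * s (pos q) * G $ pos p $ pos q"
    if p: "p \<in> {1..n}" and q: "q \<in> {1..n}" for p q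
  proof -
    consider "p = q" | "q = p + 1" | "p = q + 1" | "\<bar>int p - int q\<bar> \<ge> 2"
      by linarith
    then show ?thesis
    proof cases
      case 1
      then show ?thesis
        by (simp add: M diag ss)
    next
      case 2
      then show ?thesis
        using next_entry[of p] p q by (simp add: M pos_eq)
    next
      case 3
      moreover have "G $ pos p $ pos q = G $ pos q $ pos p"
        by (simp add: G inner_commute)
      ultimately show ?thesis
        using next_entry[of q] p q by (simp add: M pos_eq mult.commute)
    next
      case 4
      then have "p \<noteq> q" "G $ pos p $ pos q = 0"
        using p q tridiag[of p q] by (auto simp: G_def)
      then show ?thesis
        using p q by (simp add: M pos_eq)
    qed
  qed
  moreover have "\<exists>p\<in>{1..n}. i = pos p" for i
    using pos by (metis UNIV_I bij_betw_imp_surj_on imageE n_def)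
  ultimately have M_eq: "M $ i $ j = s i * s j * G $ i $ j" for i j
    by metis
  \<comment> \<open>The diagonal sign matrix as a map. It is an involution, and \<open>M_eq\<close>
    says that \<open>M\<close> is \<open>G\<close> conjugated by it.\<close>
  define S :: "real^'n \<Rightarrow> real^'n" where "S x = (\<chi> i. s i * x $ i)" for x
  have S_inv: "S (S x) = x" for x
    by (simp add: S_def vec_eq_iff mult.assoc[symmetric] ss)
  have linear_S: "linear S"
    by (rule linearI) (simp_all add: S_def vec_eq_iff algebra_simps)
  have inj_S: "inj S"
    using S_inv by (metis injI)
  have M_S: "M *v x = S (G *v S x)" for x
    by (simp add: vec_eq_iff matrix_vector_mult_def M_eq S_def sum_distrib_left mult_ac)
  have eigenspace: "eigenspace M \<mu> = S ` eigenspace G \<mu>" for \<mu>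
  proof -
    have "M *v x = \<mu> *\<^sub>R x \<longleftrightarrow> G *v S x = \<mu> *\<^sub>R S x" for x
      unfolding M_S by (metis S_inv linear_S linear_cmul)
    then have "eigenspace M \<mu> = S -` eigenspace G \<mu>"
      by (auto simp: eigenspace_def)
    also have "\<dots> = S ` eigenspace G \<mu>"
      by (auto simp: S_inv intro!: image_eqI[where x = "S _" and f = S])
    finally show ?thesis .
  qed
  have S_eq_0: "S x = 0 \<longleftrightarrow> x = 0" for x
    by (metis S_inv linear_0 linear_S)
  have eigenvalues: "eigenvalues M = eigenvalues G"
  proof -
    have "eigenvalues A = {\<mu>. \<exists>x\<in>eigenspace A \<mu>. x \<noteq> 0}" for A :: "real ^ 'n ^ 'n"
      by (auto simp: eigenvalues_def)
    then show ?thesis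
      by (simp add: eigenspace S_eq_0)
  qed
  \<comment> \<open>Equality of eigenvalues includes their multiplicities, because \<open>S\<close>
    maps eigenspaces isomorphically.\<close>
  have dims: "dim (eigenspace M \<mu>) = dim (eigenspace G \<mu>)" for \<mu>
    unfolding eigenspace using linear_S inj_S by (intro dim_image_eq) (auto intro: inj_on_subset)
  \<comment> \<open>\<open>S\<close> is self-adjoint, so the form of \<open>M\<close> at
    \<open>x\<close> is the form of the Gram matrix at \<open>S x\<close>.\<close>
  have quad_M: "x \<bullet> (M *v x) = (norm (V *v S x))\<^sup>2" for x
  proof -
    have "x \<bullet> S y = S x \<bullet> y" for y
      by (simp add: inner_vec_def S_def mult_ac)
    then show ?thesis
      by (simp add: M_S G_def inner_gram)
  qed
  have "positive_definite M"
    unfolding positive_definite_def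
  proof (intro conjI allI impI symM)
    fix x :: "real^'n" assume "x \<noteq> 0"
    then have "S x \<noteq> 0"
      by (simp add: S_eq_0)
    then have "V *v S x \<noteq> 0"
      using injD[OF inj, of "S x" 0] by auto
    then show "0 < x \<bullet> (M *v x)"
      by (simp add: quad_M)
  qed
  have form_G: "(norm (V *v c))\<^sup>2 = (norm c)\<^sup>2 + 2 * chain_form pos \<beta> c" for c
    unfolding inner_gram[symmetric] using pos
    by (rule quadratic_form_tridiagonal)
      (use diag symG tridiag \<beta> G in \<open>simp_all add: G_def\<close>)
  have form_M: "(norm (V *v S c))\<^sup>2 = (norm c)\<^sup>2 + 2 * chain_form pos (\<lambda>k. - \<bar>\<beta> k\<bar>) c" for c
    unfolding quad_M[symmetric] using pos
  proof (rule quadratic_form_tridiagonal)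
    show "M $ pos i $ pos j = 0"
      if "i \<in> {1..CARD('n)}" "j \<in> {1..CARD('n)}" "\<bar>int i - int j\<bar> \<ge> 2" for i j
      using tridiag[OF that] by (simp add: M_eq G_def)
    show "M $ pos i $ pos (i + 1) = - \<bar>\<beta> i\<bar>" if "i \<in> {1..<CARD('n)}" for i
      using next_entry[of i] that \<beta>[OF that] by (simp add: M_eq G)
  qed (simp_all add: M symM)
  \<comment> \<open>\<open>W\<close> is injective and \<open>(norm (W *v c))\<^sup>2\<close> is the
    form of \<open>M\<close>, so the Gaussian lemma supplies the integrability that termwise
    integration needs.\<close>
  define W where "W = V ** matrix S"
  have W: "W *v c = V *v S c" for c
    by (simp add: W_def matrix_vector_mul_assoc[symmetric] matrix_works linear_S)
  have "inj ((*v) W)"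
    by (rule injI) (simp add: W inj_eq[OF inj] inj_eq[OF inj_S])
  then have "integrable lborel
    (\<lambda>c. indicator orthant c * exp (- ((norm c)\<^sup>2 + 2 * chain_form pos (\<lambda>k. - \<bar>\<beta> k\<bar>) c)))"
    using has_bochner_integral_orthant_gaussian[of W]
    by (simp only: W form_M has_bochner_integral_iff)
  note series = angle_term_series[OF pos this]
  have summable: "(\<lambda>b. \<bar>angle_term CARD('n) \<beta> b\<bar>) summable_on multi_indices CARD('n)"
    using series(1) by (simp only: abs_summable_equivalent[symmetric] real_norm_def)
  have "angle_series V \<beta> = \<bar>det V\<bar> / (4 * pi) powr (real CARD('n) / 2) * (2 ^ CARD('n) *
      (\<integral>c. indicator orthant c * exp (- (norm (V *v c))\<^sup>2) \<partial>lborel))"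
    unfolding angle_series_def infsetsum_infsum[OF series(1), symmetric] series(2) form_G ..
  \<comment> \<open>The factor \<open>2 ^ CARD('n)\<close> from the half-line moments cancels
    against the power of \<open>4\<close>.\<close>
  also have "(4 * pi) powr (real CARD('n) / 2) = 2 ^ CARD('n) * pi powr (real CARD('n) / 2)"
  proof -
    have "(4::real) powr (real CARD('n) / 2) = (4 powr (1 / 2)) powr real CARD('n)"
      unfolding powr_powr by simp
    also have "\<dots> = 2 ^ CARD('n)"
      by (simp add: powr_half_sqrt powr_realpow)
    finally show ?thesis
      by (simp add: powr_mult)
  qed
  finally have "angle_series V \<beta> = solid_angle (gen_cone v)"
    by (simp add: solid_angle_gen_cone[OF V inj])
  with eigenvalues dims \<open>positive_definite M\<close> summable show ?thesis
    by (simp add: M_def G_def)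
qed

end
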